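(* Let $\mathcal{K}=(K,\leq,\Vdash)$ be a finite-depth Kripke model for the propositional language $\mathcal{L}_0$. Then for every $\alpha\in K$ there exists $\rho\in{\sf PEM}(\mathcal{L}_0)^*$ such that for every propositional formula $A$, $$\alpha\Vdash A^{\rho}\quad\text{iff}\quad\alpha\models A.$$
   Context: $\mathcal{L}_0$ is the propositional language with connectives $\vee,\wedge,\to,\bot$ and propositional variables; $\neg A$ abbreviates $A\to\bot$. A propositional Kripke model is $(K,\leq,\Vdash)$ with $(K,\leq)$ a nonempty poset and $\Vdash$ a relation between nodes and propositional variables that is monotone along $\leq$, extended to all formulas in the standard intuitionistic way ($\bot$ never forced, $\alpha\Vdash A\to B$ iff every $\beta\geq\alpha$ forcing $A$ forces $B$). $\alpha\models A$ means that $A$ is true in the classical valuation at $\alpha$ which makes a variable true iff it is forced at $\alpha$. The depth of the model is the maximum $n$ such that no chain in $(K,\leq)$ is longer than $n$; finite depth means such $n$ exists. For a formula $\rho$, the Friedman translation $A^\rho$ replaces each atomic subformula $P$ (including $\bot$) by $P\vee\rho$ and commutes with $\wedge,\vee,\to$. ${\sf PEM}(\mathcal{L}_0)$ is the set of all formulas $A\vee\neg A$ with $A\in\mathcal{L}_0$. For a set $\Gamma$ of formulas, $\Gamma^*=\bigcup_n\Gamma^n$ where $\Gamma^0=\{\bot\}$ and $\Gamma^{n+1}=\{A^B:A\in\Gamma^n,\ B\in\Gamma\}$. *)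

theory Defs
  imports Main
begin

datatype 'p form =
    Var 'p
  | Bot
  | And "'p form" "'p form"
  | Or "'p form" "'p form"
  | Imp "'p form" "'p form"

abbreviation Neg :: "'p form \<Rightarrow> 'p form" where
  "Neg A \<equiv> Imp A Bot"

locale kripke_model =
  fixes K :: "'w set"
    and le :: "('w \<times> 'w) set"
    and val :: "'w \<Rightarrow> 'p \<Rightarrow> bool"
  assumes nonempty: "K \<noteq> {}"
    and poset: "partial_order_on K le"
    and val_mono: "\<lbrakk>(\<alpha>, \<beta>) \<in> le; val \<alpha> p\<rbrakk> \<Longrightarrow> val \<beta> p"

primrec forces ::
  "'w set \<Rightarrow> ('w \<times> 'w) set \<Rightarrow> ('w \<Rightarrow> 'p \<Rightarrow> bool) \<Rightarrow> 'w \<Rightarrow> 'p form \<Rightarrow> bool" where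
  "forces K le val \<alpha> (Var p) \<longleftrightarrow> val \<alpha> p"
| "forces K le val \<alpha> Bot \<longleftrightarrow> False"
| "forces K le val \<alpha> (And A B) \<longleftrightarrow> forces K le val \<alpha> A \<and> forces K le val \<alpha> B"
| "forces K le val \<alpha> (Or A B) \<longleftrightarrow> forces K le val \<alpha> A \<or> forces K le val \<alpha> B"
| "forces K le val \<alpha> (Imp A B) \<longleftrightarrow>
     (\<forall>\<beta>\<in>K. (\<alpha>, \<beta>) \<in> le \<longrightarrow> forces K le val \<beta> A \<longrightarrow> forces K le val \<beta> B)"

primrec classical_true :: "('p \<Rightarrow> bool) \<Rightarrow> 'p form \<Rightarrow> bool" where
  "classical_true v (Var p) \<longleftrightarrow> v p"
| "classical_true v Bot \<longleftrightarrow> False"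
| "classical_true v (And A B) \<longleftrightarrow> classical_true v A \<and> classical_true v B"
| "classical_true v (Or A B) \<longleftrightarrow> classical_true v A \<or> classical_true v B"
| "classical_true v (Imp A B) \<longleftrightarrow> (classical_true v A \<longrightarrow> classical_true v B)"

text \<open>Since \<^term>\<open>le\<close> is contained in \<open>K \<times> K\<close> for a Kripke model on \<open>K\<close>, the
  members of \<^term>\<open>Chains le\<close> are exactly the chains of \<open>(K, \<le>)\<close>. The length of a chain is
  its number of elements; finiteness is stated separately because \<open>card\<close> is 0 on infinite sets.\<close>

definition finite_depth :: "('w \<times> 'w) set \<Rightarrow> bool" where
  "finite_depth le \<longleftrightarrow> (\<exists>n::nat. \<forall>C\<in>Chains le. finite C \<and> card C \<le> n)"

primrec friedman :: "'p form \<Rightarrow> 'p form \<Rightarrow> 'p form" where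
  "friedman \<rho> (Var p) = Or (Var p) \<rho>"
| "friedman \<rho> Bot = Or Bot \<rho>"
| "friedman \<rho> (And A B) = And (friedman \<rho> A) (friedman \<rho> B)"
| "friedman \<rho> (Or A B) = Or (friedman \<rho> A) (friedman \<rho> B)"
| "friedman \<rho> (Imp A B) = Imp (friedman \<rho> A) (friedman \<rho> B)"

definition PEM :: "'p form set" where
  "PEM = {Or A (Neg A) | A. True}"

primrec friedman_iter :: "'p form set \<Rightarrow> nat \<Rightarrow> 'p form set" where
  "friedman_iter \<Gamma> 0 = {Bot}"
| "friedman_iter \<Gamma> (Suc n) = {friedman B A | A B. A \<in> friedman_iter \<Gamma> n \<and> B \<in> \<Gamma>}"

definition friedman_star :: "'p form set \<Rightarrow> 'p form set" where
  "friedman_star \<Gamma> = (\<Union>n. friedman_iter \<Gamma> n)"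

end

theory Submission
  imports Defs
begin

text \<open>At a node not forcing \<open>\<rho>\<close>, the formula \<open>A\<^sup>\<rho>\<close> is forced exactly when \<open>A\<close> is forced after
  deleting all nodes that force \<open>\<rho>\<close>. If \<open>\<alpha>\<close> forces every instance of excluded middle, then forcing
  at \<open>\<alpha>\<close> is classical truth and \<open>\<rho> = \<bottom>\<close> works. Otherwise delete the nodes forcing an instance
  \<open>B = C \<or> \<not>C\<close> that fails at \<open>\<alpha>\<close>. Every surviving node lies below a deleted one, so the depth
  drops; a formula \<open>\<rho>\<close> obtained inductively for the smaller model yields \<open>\<rho>\<^sup>B\<close> for the original
  one, because \<open>(A\<^sup>\<rho>)\<^sup>B\<close> is equivalent to \<open>A\<close> translated by \<open>\<rho>\<^sup>B\<close>.\<close>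

lemma finite_chain_has_greatest:
  assumes "finite C" and "C \<noteq> {}" and "C \<in> Chains r" and "trans r"
  shows "\<exists>m\<in>C. \<forall>x\<in>C. (x, m) \<in> r"
  using assms(1-3)
proof (induction C rule: finite_ne_induct)
  case (singleton x)
  then show ?case by (auto simp: Chains_def)
next
  case (insert x C)
  then obtain m where m: "m \<in> C" "\<forall>y\<in>C. (y, m) \<in> r" by (auto simp: Chains_def)
  have "(x, x) \<in> r" "(x, m) \<in> r \<or> (m, x) \<in> r"
    using insert.prems m(1) by (auto simp: Chains_def)
  then show ?case using m transD[OF assms(4)] by blast
qed

lemma forces_friedman_Bot_iff:
  "forces K le val \<alpha> (friedman Bot A) \<longleftrightarrow> forces K le val \<alpha> A"
  by (induction A arbitrary: \<alpha>) auto

text \<open>The carrier stays out of the assumptions, so the lemmas below apply unchanged when nodes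
  are deleted from it while \<open>le\<close> and \<open>val\<close> stay fixed.\<close>

context
  fixes le :: "('w \<times> 'w) set" and val :: "'w \<Rightarrow> 'p \<Rightarrow> bool"
  assumes trans_le: "trans le"
    and val_le: "(\<alpha>, \<beta>) \<in> le \<Longrightarrow> val \<alpha> p \<Longrightarrow> val \<beta> p"
begin

lemma forces_mono:
  assumes "(\<alpha>, \<beta>) \<in> le" and "forces K le val \<alpha> A"
  shows "forces K le val \<beta> A"
  using assms
proof (induction A arbitrary: \<alpha> \<beta>)
  case (Imp A B)
  then have "\<And>\<gamma>. (\<beta>, \<gamma>) \<in> le \<Longrightarrow> (\<alpha>, \<gamma>) \<in> le"
    using trans_le by (blast dest: transD)
  then show ?case using Imp.prems(2) by simp
next
  case (Var p)
  then show ?case using val_le by simp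
qed auto

lemma forces_friedman:
  assumes "forces K le val \<alpha> \<rho>"
  shows "forces K le val \<alpha> (friedman \<rho> A)"
  using assms
proof (induction A arbitrary: \<alpha>)
  case (Imp A B)
  have "forces K le val \<beta> (friedman \<rho> B)" if "(\<alpha>, \<beta>) \<in> le" for \<beta>
    using Imp.IH(2) forces_mono[OF that Imp.prems] by blast
  then show ?case by simp
qed auto

text \<open>In the implication case, a node forcing \<open>\<rho>\<close> forces the translated
  conclusion by \<open>forces_friedman\<close>, so it imposes no condition and may be dropped; the
  induction hypothesis covers the rest.\<close>

lemma forces_friedman_iff_pruned:
  assumes "\<not> forces K le val \<alpha> \<rho>"
  shows "forces K le val \<alpha> (friedman \<rho> A) \<longleftrightarrow>
         forces {\<beta> \<in> K. \<not> forces K le val \<beta> \<rho>} le val \<alpha> A"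
  using assms
proof (induction A arbitrary: \<alpha>)
  case (Imp A B)
  show ?case
    unfolding friedman.simps forces.simps using Imp.IH forces_friedman[of K _ \<rho>] by blast
qed auto

text \<open>The two sides differ only at atoms, where the left one has the extra disjunct
  \<open>B\<close>. It is absorbed, since forcing \<open>B\<close> implies forcing
  \<open>friedman B \<rho>\<close>.\<close>

lemma forces_friedman_friedman_iff:
  shows "forces K le val \<alpha> (friedman B (friedman \<rho> A)) \<longleftrightarrow>
         forces K le val \<alpha> (friedman (friedman B \<rho>) A)"
  using forces_friedman[of K _ B \<rho>]
  by (induction A arbitrary: \<alpha>) auto

text \<open>Only implication looks beyond \<open>\<alpha>\<close>. If \<open>Neg A\<close> is
  forced, \<open>Imp A B\<close> holds vacuously; if \<open>A\<close> is forced, persistence of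
  \<open>B\<close> reduces the implication to \<open>\<alpha>\<close>.\<close>

lemma forces_iff_classical_true:
  assumes "\<alpha> \<in> K" and "(\<alpha>, \<alpha>) \<in> le"
    and pem: "\<And>B. B \<in> PEM \<Longrightarrow> forces K le val \<alpha> B"
  shows "forces K le val \<alpha> A \<longleftrightarrow> classical_true (val \<alpha>) A"
proof (induction A)
  case (Imp A B)
  have "forces K le val \<alpha> (Or A (Neg A))"
    using pem unfolding PEM_def by blast
  then have "forces K le val \<alpha> (Imp A B) \<longleftrightarrow>
      (forces K le val \<alpha> A \<longrightarrow> forces K le val \<alpha> B)"
    using assms(1,2) forces_mono[of _ _ K] by auto
  then show ?case using Imp.IH by simp
qed auto

lemma exists_friedman_star_classical:
  assumes refl: "\<And>\<beta>. \<beta> \<in> K \<Longrightarrow> (\<beta>, \<beta>) \<in> le"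
    and depth: "\<And>C. C \<in> Chains le \<Longrightarrow> C \<subseteq> K \<Longrightarrow> finite C \<and> card C \<le> n"
    and "\<alpha> \<in> K"
  shows "\<exists>\<rho>\<in>friedman_star PEM.
           \<forall>A. forces K le val \<alpha> (friedman \<rho> A) \<longleftrightarrow> classical_true (val \<alpha>) A"
  using refl depth \<open>\<alpha> \<in> K\<close>
proof (induction n arbitrary: K)
  case 0
  \<comment> \<open>The bound 0 is contradictory: a singleton is already a chain with one
    element.\<close>
  then have "{\<alpha>} \<in> Chains le" by (auto simp: Chains_def)
  then show ?case using 0 by fastforce
next
  case (Suc n)
  show ?case
  proof (cases "\<forall>B\<in>PEM. forces K le val \<alpha> B")
    case True
    have "Bot \<in> friedman_star PEM"
      unfolding friedman_star_def by (auto intro: exI[of _ 0])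
    moreover have "forces K le val \<alpha> (friedman Bot A) \<longleftrightarrow> classical_true (val \<alpha>) A" for A
      using forces_iff_classical_true Suc.prems True
      by (simp add: forces_friedman_Bot_iff)
    ultimately show ?thesis by blast
  next
    case False
    then obtain C where C: "\<not> forces K le val \<alpha> (Or C (Neg C))"
      unfolding PEM_def by blast
    define B where "B = Or C (Neg C)"
    define K' where "K' = {\<beta> \<in> K. \<not> forces K le val \<beta> B}"
    have "finite D \<and> card D \<le> n" if D: "D \<in> Chains le" "D \<subseteq> K'" for D
    proof (cases "D = {}")
      case False
      have fin: "finite D" using Suc.prems(2) D unfolding K'_def by blast
      obtain m where m: "m \<in> D" "\<forall>x\<in>D. (x, m) \<in> le"
        using finite_chain_has_greatest[OF fin False D(1) trans_le] by blast
      have "\<not> forces K le val m B" using m(1) D(2) unfolding K'_def by blast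
      \<comment> \<open>The top \<open>m\<close> of \<open>D\<close> does not force
        \<open>Neg C\<close>, so some \<open>\<beta>\<close> above it forces \<open>C\<close>, hence
        \<open>B\<close>. This deleted node extends \<open>D\<close> by one element inside
        \<open>K\<close>, where the bound is \<open>Suc n\<close>.\<close>
      then obtain \<beta> where \<beta>: "\<beta> \<in> K" "(m, \<beta>) \<in> le" "forces K le val \<beta> C"
        unfolding B_def by auto
      have "\<beta> \<notin> D" using \<beta>(3) D(2) unfolding K'_def B_def by auto
      moreover have "insert \<beta> D \<in> Chains le"
        using D(1) m(2) \<beta>(2) Suc.prems(1)[OF \<beta>(1)] transD[OF trans_le]
        unfolding Chains_def by blast
      moreover have "insert \<beta> D \<subseteq> K" using \<beta>(1) D(2) unfolding K'_def by blast
      ultimately show ?thesis using Suc.prems(2)[of "insert \<beta> D"] fin by simp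
    qed simp
    moreover have "\<alpha> \<in> K'" using C Suc.prems(3) unfolding K'_def B_def by blast
    ultimately obtain \<rho> where \<rho>: "\<rho> \<in> friedman_star PEM"
      "\<And>A. forces K' le val \<alpha> (friedman \<rho> A) \<longleftrightarrow> classical_true (val \<alpha>) A"
      using Suc.IH[of K'] Suc.prems(1) unfolding K'_def by blast
    \<comment> \<open>Translating by \<open>B\<close> last matches the shape of
      \<open>friedman_iter\<close>: the instance used for the first deletion is the outermost
      one.\<close>
    have "B \<in> PEM" unfolding B_def PEM_def by blast
    moreover obtain k where "\<rho> \<in> friedman_iter PEM k"
      using \<rho>(1) unfolding friedman_star_def by blast
    ultimately have "friedman B \<rho> \<in> friedman_iter PEM (Suc k)" by auto
    then have "friedman B \<rho> \<in> friedman_star PEM" unfolding friedman_star_def by blast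
    moreover have "forces K le val \<alpha> (friedman (friedman B \<rho>) A) \<longleftrightarrow>
        classical_true (val \<alpha>) A" for A
    proof -
      have "forces K le val \<alpha> (friedman B (friedman \<rho> A)) \<longleftrightarrow>
          forces K' le val \<alpha> (friedman \<rho> A)"
        unfolding K'_def
        using forces_friedman_iff_pruned C
        unfolding B_def by blast
      then show ?thesis
        using \<rho>(2) forces_friedman_friedman_iff by blast
    qed
    ultimately show ?thesis by blast
  qed
qed

end

theorem mainTheorem2:
  fixes K :: "'w set" and le :: "('w \<times> 'w) set" and val :: "'w \<Rightarrow> 'p \<Rightarrow> bool"
  assumes "kripke_model K le val"
    and "finite_depth le"
  shows "\<forall>\<alpha>\<in>K. \<exists>\<rho>\<in>friedman_star (PEM :: 'p form set).
           \<forall>A :: 'p form. forces K le val \<alpha> (friedman \<rho> A) \<longleftrightarrow> classical_true (val \<alpha>) A"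
proof
  fix \<alpha> assume "\<alpha> \<in> K"
  interpret kripke_model K le val by fact
  have "trans le" "\<And>\<beta>. \<beta> \<in> K \<Longrightarrow> (\<beta>, \<beta>) \<in> le"
    using poset by (auto simp: partial_order_on_def preorder_on_def dest: refl_onD)
  moreover obtain n where "\<forall>C\<in>Chains le. finite C \<and> card C \<le> n"
    using assms(2) unfolding finite_depth_def by blast
  ultimately show "\<exists>\<rho>\<in>friedman_star (PEM :: 'p form set).
      \<forall>A :: 'p form. forces K le val \<alpha> (friedman \<rho> A) \<longleftrightarrow> classical_true (val \<alpha>) A"
    using exists_friedman_star_classical[of le val K n \<alpha>] val_mono \<open>\<alpha> \<in> K\<close> by blast
qed

end
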